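(* For $n\ge 1$ and $r\ge 0$ let $N_n(r)$ denote the number of $n\times n$ linking matrices $\Lambda$ all of whose entries are $0$ or $1$ (there are $2^{\binom n2}$ such matrices) for which the $\mathbb{Z}/2$-vector space $\mathcal{M}(\Lambda)\otimes\mathbb{Z}/2$ has dimension $r$ (i.e. $\operatorname{rank}_{\mathbb{Z}/2}(\mathcal{M}(\Lambda)\otimes \mathbb{Z}/2)=r$). (1) For $n=4$ (total $2^6$ matrices): $N_4(0)=36$, $N_4(1)=21$, $N_4(2)=6$, $N_4(3)=0$, $N_4(4)=1$. (2) For $n=5$ (total $2^{10}$ matrices): $N_5(0)=132$, $N_5(1)=450$, $N_5(2)=180$, $N_5(3)=165$, $N_5(4)=46$, $N_5(5)=40$, $N_5(6)=0$, $N_5(7)=10$, $N_5(8)=0$, $N_5(9)=0$, $N_5(10)=1$. (3) For $n=6$ (total $2^{15}$ matrices): $N_6(0)=0$, $N_6(1)=0$, $N_6(2)=5712$, $N_6(3)=7920$, $N_6(4)=8595$, $N_6(5)=4035$, $N_6(6)=1627$, $N_6(7)=3030$, $N_6(8)=855$, $N_6(9)=240$, $N_6(10)=538$, $N_6(11)=75$, $N_6(12)=45$, $N_6(13)=80$, $N_6(14)=0$, $N_6(15)=0$, $N_6(16)=15$, $N_6(17)=0$, $N_6(18)=0$, $N_6(19)=0$, $N_6(20)=1$.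
   Context: A linking matrix is a symmetric $n\times n$ matrix $\Lambda=(\Lambda_{ij})$ with integer entries and zeros on the main diagonal. Let $e_1,\dots,e_n$ be the standard basis of $\mathbb{Z}^n$ and, for $1\le i,j,k\le n$, put $X^{ijk}=e_i\wedge e_j\wedge e_k\in \mathbb{Z}^n\wedge\mathbb{Z}^n\wedge\mathbb{Z}^n$ (third exterior power). Thus $X^{ijk}=0$ if two of the indices coincide, $X^{ijk}=X^{jki}=X^{kij}=-X^{ikj}=-X^{jik}=-X^{kji}$, and $\{X^{ijk}:1\le i<j<k\le n\}$ is a basis, giving an identification with $\mathbb{Z}^{\binom n3}$. For $1\le j\ne k\le n$ let $v_{jk}=\sum_{i=1}^n \Lambda_{ik}X^{ijk}$, and let $V(\Lambda)\subseteq\mathbb{Z}^{\binom n3}$ be the subgroup generated by all $v_{jk}$, $1\le j\neq k\le n$. The total Milnor quotient associated with $\Lambda$ is the abelian group $\mathcal{M}(\Lambda)=\mathbb{Z}^{\binom n3}/V(\Lambda)$. Tensor products are over $\mathbb{Z}$. *)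

theory Defs
  imports
    "HOL-Algebra.Free_Abelian_Groups"
    "HOL-Number_Theory.Residues"
    "Jordan_Normal_Form.Missing_VectorSpace"
    "Jordan_Normal_Form.Matrix"
begin

section \<open>Linking matrices\<close>

definition linking_matrix :: "nat \<Rightarrow> int mat \<Rightarrow> bool" where
  "linking_matrix n L \<longleftrightarrow>
     L \<in> carrier_mat n n \<and> transpose_mat L = L \<and> (\<forall>i<n. L $$ (i, i) = 0)"

definition binary_linking_matrices :: "nat \<Rightarrow> int mat set" where
  "binary_linking_matrices n =
     {L. linking_matrix n L \<and> (\<forall>i<n. \<forall>j<n. L $$ (i, j) \<in> {0, 1})}"


section \<open>The third exterior power\<close>

text \<open>Indices run over \<open>0, \<dots>, n - 1\<close> (instead of \<open>1, \<dots>, n\<close>). The third exterior power of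
  \<open>\<int>\<^sup>n\<close> is taken in its standard coordinates: the free abelian group on the triples
  \<open>a < b < c < n\<close>. The coordinate of \<open>u \<and> v \<and> w\<close> at such a triple is the corresponding
  \<open>3 \<times> 3\<close> minor of the matrix with rows \<open>u\<close>, \<open>v\<close>, \<open>w\<close>.\<close>

definition triples :: "nat \<Rightarrow> (nat \<times> nat \<times> nat) set" where
  "triples n = {(a, b, c). a < b \<and> b < c \<and> c < n}"

definition exterior_cube :: "nat \<Rightarrow> (nat \<times> nat \<times> nat \<Rightarrow>\<^sub>0 int) monoid" where
  "exterior_cube n = free_Abelian_group (triples n)"

definition minor3 :: "int vec \<Rightarrow> int vec \<Rightarrow> int vec \<Rightarrow> nat \<times> nat \<times> nat \<Rightarrow> int" where
  "minor3 u v w = (\<lambda>(a, b, c).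
       u $ a * (v $ b * w $ c - v $ c * w $ b)
     - u $ b * (v $ a * w $ c - v $ c * w $ a)
     + u $ c * (v $ a * w $ b - v $ b * w $ a))"

definition wedge3 :: "nat \<Rightarrow> int vec \<Rightarrow> int vec \<Rightarrow> int vec \<Rightarrow> (nat \<times> nat \<times> nat \<Rightarrow>\<^sub>0 int)" where
  "wedge3 n u v w = (\<Sum>t\<in>triples n. frag_cmul (minor3 u v w t) (frag_of t))"

definition X :: "nat \<Rightarrow> nat \<Rightarrow> nat \<Rightarrow> nat \<Rightarrow> (nat \<times> nat \<times> nat \<Rightarrow>\<^sub>0 int)" where
  "X n i j k = wedge3 n (unit_vec n i) (unit_vec n j) (unit_vec n k)"

lemma finite_triples: "finite (triples n)"
  by (rule finite_subset[of _ "{..<n} \<times> {..<n} \<times> {..<n}"]) (auto simp: triples_def)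

lemma lookup_wedge3:
  "Poly_Mapping.lookup (wedge3 n u v w) t = (if t \<in> triples n then minor3 u v w t else 0)"
  by (simp add: wedge3_def lookup_sum finite_triples if_distrib cong: if_cong)

lemma wedge3_closed: "wedge3 n u v w \<in> carrier (exterior_cube n)"
  by (auto simp: exterior_cube_def in_keys_iff lookup_wedge3 split: if_splits)

lemma wedge3_add:
  assumes "u \<in> carrier_vec n" "u' \<in> carrier_vec n" "v \<in> carrier_vec n" "w \<in> carrier_vec n"
  shows "wedge3 n (u + u') v w = wedge3 n u v w + wedge3 n u' v w"
  using assms
  by (intro poly_mapping_eqI)
     (auto simp: lookup_add lookup_wedge3 minor3_def triples_def algebra_simps)

lemma wedge3_alternating: "wedge3 n u u w = 0" "wedge3 n u w w = 0" "wedge3 n u w u = 0"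
  by (auto intro!: poly_mapping_eqI simp: lookup_wedge3 minor3_def algebra_simps)

lemma wedge3_permute:
  "wedge3 n u v w = wedge3 n v w u" "wedge3 n u v w = wedge3 n w u v"
  "wedge3 n u v w = - wedge3 n u w v" "wedge3 n u v w = - wedge3 n v u w"
  "wedge3 n u v w = - wedge3 n w v u"
  by (auto intro!: poly_mapping_eqI simp: lookup_wedge3 minor3_def algebra_simps)

lemma X_basis: "i < j \<Longrightarrow> j < k \<Longrightarrow> k < n \<Longrightarrow> X n i j k = frag_of (i, j, k)"
  by (intro poly_mapping_eqI) (auto simp: X_def lookup_wedge3 minor3_def triples_def split: if_splits)

lemma X_coincide: "X n i i k = 0" "X n i k k = 0" "X n i k i = 0"
  by (simp_all add: X_def wedge3_alternating)

lemma X_permute: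
  "X n i j k = X n j k i" "X n i j k = X n k i j"
  "X n i j k = - X n i k j" "X n i j k = - X n j i k" "X n i j k = - X n k j i"
  unfolding X_def by (rule wedge3_permute)+


section \<open>The total Milnor quotient\<close>

definition v_elem :: "nat \<Rightarrow> int mat \<Rightarrow> nat \<Rightarrow> nat \<Rightarrow> (nat \<times> nat \<times> nat \<Rightarrow>\<^sub>0 int)" where
  "v_elem n L j k = (\<Sum>i<n. frag_cmul (L $$ (i, k)) (X n i j k))"

definition V_subgroup :: "nat \<Rightarrow> int mat \<Rightarrow> (nat \<times> nat \<times> nat \<Rightarrow>\<^sub>0 int) set" where
  "V_subgroup n L = generate (exterior_cube n) {v_elem n L j k | j k. j < n \<and> k < n \<and> j \<noteq> k}"

definition milnor_quotient :: "nat \<Rightarrow> int mat \<Rightarrow> (nat \<times> nat \<times> nat \<Rightarrow>\<^sub>0 int) set monoid" where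
  "milnor_quotient n L = exterior_cube n Mod V_subgroup n L"

lemma v_elem_closed: "v_elem n L j k \<in> carrier (exterior_cube n)"
  unfolding v_elem_def exterior_cube_def
  using wedge3_closed[of n, unfolded exterior_cube_def]
  by (intro sum_closed_free_Abelian_group) (auto simp: X_def dest!: subsetD)

lemma comm_group_exterior_cube: "comm_group (exterior_cube n)"
  by (simp add: exterior_cube_def abelian_free_Abelian_group)

lemma comm_group_milnor_quotient: "comm_group (milnor_quotient n L)"
proof -
  interpret E: comm_group "exterior_cube n" by (rule comm_group_exterior_cube)
  have "subgroup (V_subgroup n L) (exterior_cube n)"
    unfolding V_subgroup_def using v_elem_closed by (intro E.generate_is_subgroup) blast
  then show ?thesis
    unfolding milnor_quotient_def by (rule E.abelian_FactGroup)
qed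


section \<open>Tensor products of abelian groups\<close>

definition tensor_relations ::
  "('a, 'c) monoid_scheme \<Rightarrow> ('b, 'd) monoid_scheme \<Rightarrow> ('a \<times> 'b \<Rightarrow>\<^sub>0 int) set" where
  "tensor_relations G H =
     {frag_of (x \<otimes>\<^bsub>G\<^esub> x', y) - frag_of (x, y) - frag_of (x', y) | x x' y.
        x \<in> carrier G \<and> x' \<in> carrier G \<and> y \<in> carrier H} \<union>
     {frag_of (x, y \<otimes>\<^bsub>H\<^esub> y') - frag_of (x, y) - frag_of (x, y') | x y y'.
        x \<in> carrier G \<and> y \<in> carrier H \<and> y' \<in> carrier H}"

definition tensor_kernel ::
  "('a, 'c) monoid_scheme \<Rightarrow> ('b, 'd) monoid_scheme \<Rightarrow> ('a \<times> 'b \<Rightarrow>\<^sub>0 int) set" where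
  "tensor_kernel G H =
     generate (free_Abelian_group (carrier G \<times> carrier H)) (tensor_relations G H)"

definition tensor_group ::
  "('a, 'c) monoid_scheme \<Rightarrow> ('b, 'd) monoid_scheme \<Rightarrow> ('a \<times> 'b \<Rightarrow>\<^sub>0 int) set monoid" where
  "tensor_group G H =
     free_Abelian_group (carrier G \<times> carrier H) Mod tensor_kernel G H"

definition pure_tensor ::
  "('a, 'c) monoid_scheme \<Rightarrow> ('b, 'd) monoid_scheme \<Rightarrow> 'a \<Rightarrow> 'b \<Rightarrow> ('a \<times> 'b \<Rightarrow>\<^sub>0 int) set" where
  "pure_tensor G H x y =
     tensor_kernel G H #>\<^bsub>free_Abelian_group (carrier G \<times> carrier H)\<^esub> frag_of (x, y)"

lemma tensor_kernel_subgroup: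
  assumes "group G" "group H"
  shows "subgroup (tensor_kernel G H) (free_Abelian_group (carrier G \<times> carrier H))"
proof -
  interpret G: group G by fact
  interpret H: group H by fact
  interpret F: group "free_Abelian_group (carrier G \<times> carrier H)" by simp
  show ?thesis
    unfolding tensor_kernel_def
    by (rule F.generate_is_subgroup) (auto simp: tensor_relations_def in_keys_iff lookup_minus split: if_splits)
qed

lemma comm_group_tensor_group:
  assumes "group G" "group H"
  shows "comm_group (tensor_group G H)"
  unfolding tensor_group_def
  by (intro comm_group.abelian_FactGroup abelian_free_Abelian_group tensor_kernel_subgroup assms)


section \<open>Reduction modulo two\<close>

abbreviation F2 :: "int ring" where
  "F2 \<equiv> residue_ring 2"

text \<open>An abelian group of exponent two carries exactly one structure of a vector space over
  \<open>\<int>/2\<close>; the residue classes \<open>0\<close> and \<open>1\<close> act as the corresponding integers. The fields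
  \<open>mult\<close> and \<open>one\<close> of the record belong to a ring multiplication and play no role.\<close>

definition F2_space :: "('a, 'c) monoid_scheme \<Rightarrow> (int, 'a) module" where
  "F2_space A = \<lparr>carrier = carrier A, monoid.mult = undefined, one = undefined,
     zero = \<one>\<^bsub>A\<^esub>, add = (\<otimes>\<^bsub>A\<^esub>), smult = (\<lambda>c x. x [^]\<^bsub>A\<^esub> c)\<rparr>"

definition milnor_mod2 ::
  "nat \<Rightarrow> int mat \<Rightarrow> (int, ((nat \<times> nat \<times> nat \<Rightarrow>\<^sub>0 int) set \<times> int \<Rightarrow>\<^sub>0 int) set) module" where
  "milnor_mod2 n L = F2_space (tensor_group (milnor_quotient n L) (add_monoid F2))"

definition num_linking :: "nat \<Rightarrow> nat \<Rightarrow> nat" where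
  "num_linking n r =
     card {L \<in> binary_linking_matrices n. vectorspace.dim F2 (milnor_mod2 n L) = r}"

lemma field_F2: "field F2"
  using residues_prime.is_field[of 2] by (simp add: residues_prime_def)

lemma comm_group_F2: "comm_group (add_monoid F2)"
proof -
  interpret field F2 by (rule field_F2)
  show ?thesis by (rule a_comm_group)
qed

lemma carrier_F2: "carrier F2 = {0, 1}"
  by (auto simp: residue_ring_def)

lemma F2_simps:
  "x \<oplus>\<^bsub>F2\<^esub> y = (x + y) mod 2" "x \<otimes>\<^bsub>F2\<^esub> y = (x * y) mod 2" "\<one>\<^bsub>F2\<^esub> = 1" "\<zero>\<^bsub>F2\<^esub> = 0"
  by (simp_all add: residue_ring_def)

lemma vectorspace_F2_space:
  assumes "comm_group A" and exp2: "\<And>x. x \<in> carrier A \<Longrightarrow> x \<otimes>\<^bsub>A\<^esub> x = \<one>\<^bsub>A\<^esub>"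
  shows "vectorspace F2 (F2_space A)"
proof -
  interpret A: comm_group A by fact
  have pow: "x [^]\<^bsub>A\<^esub> (0::int) = \<one>\<^bsub>A\<^esub>" "x [^]\<^bsub>A\<^esub> (1::int) = x" if "x \<in> carrier A" for x
    using that by simp_all
  show ?thesis
    by (rule vs_criteria[OF field_F2])
       (use exp2 A.m_comm A.m_assoc A.inv_closed A.r_inv in
         \<open>auto simp: F2_space_def carrier_F2 F2_simps pow\<close>)
qed

lemma
  assumes "comm_group G" and g: "g \<in> carrier G" and s: "s \<in> carrier F2"
  shows tensor_kernel_zero: "frag_of (g, 0) \<in> tensor_kernel G (add_monoid F2)"
    and tensor_kernel_double: "frag_of (g, s) + frag_of (g, s) \<in> tensor_kernel G (add_monoid F2)"
proof -
  let ?H = "add_monoid F2"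
  let ?F = "free_Abelian_group (carrier G \<times> carrier ?H)"
  interpret G: comm_group G by fact
  interpret H: comm_group ?H by (rule comm_group_F2)
  have K: "subgroup (tensor_kernel G ?H) ?F"
    by (intro tensor_kernel_subgroup G.is_group H.is_group)
  have minus: "- f \<in> tensor_kernel G ?H" if "f \<in> tensor_kernel G ?H" for f
    using subgroup.m_inv_closed[OF K that] subgroup.subset[OF K] that by auto
  have add: "f + f' \<in> tensor_kernel G ?H"
    if "f \<in> tensor_kernel G ?H" "f' \<in> tensor_kernel G ?H" for f f'
    using subgroup.m_closed[OF K that] by simp
  have rel: "frag_of (g, t \<oplus>\<^bsub>F2\<^esub> t) - frag_of (g, t) - frag_of (g, t) \<in> tensor_kernel G ?H"
    if "t \<in> carrier F2" for t
    unfolding tensor_kernel_def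
    by (rule generate.incl) (use that g in \<open>force simp: tensor_relations_def\<close>)
  have dbl: "t \<oplus>\<^bsub>F2\<^esub> t = 0" if "t \<in> carrier F2" for t
    using that by (auto simp: residue_ring_def)
  have "frag_of (g, 0) - frag_of (g, 0) - frag_of (g, 0) \<in> tensor_kernel G ?H"
    using rel[of 0] dbl[of 0] by (simp add: carrier_F2)
  from minus[OF this] show zero: "frag_of (g, 0) \<in> tensor_kernel G ?H" by simp
  have "frag_of (g, 0) - frag_of (g, s) - frag_of (g, s) \<in> tensor_kernel G ?H"
    using rel[OF s] dbl[OF s] by simp
  from add[OF minus[OF this] zero]
  show "frag_of (g, s) + frag_of (g, s) \<in> tensor_kernel G ?H" by (simp add: algebra_simps)
qed

lemma tensor_F2_exponent:
  assumes "comm_group G" and x: "x \<in> carrier (tensor_group G (add_monoid F2))"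
  shows "x \<otimes>\<^bsub>tensor_group G (add_monoid F2)\<^esub> x = \<one>\<^bsub>tensor_group G (add_monoid F2)\<^esub>"
proof -
  let ?H = "add_monoid F2"
  let ?S = "carrier G \<times> carrier ?H"
  let ?F = "free_Abelian_group ?S"
  let ?K = "tensor_kernel G ?H"
  interpret G: comm_group G by fact
  interpret H: comm_group ?H by (rule comm_group_F2)
  interpret F: comm_group ?F by (rule abelian_free_Abelian_group)
  have K: "subgroup ?K ?F"
    by (intro tensor_kernel_subgroup G.is_group H.is_group)
  interpret N: normal ?K ?F by (rule F.subgroup_imp_normal[OF K])
  from x obtain f where f: "f \<in> carrier ?F" "x = ?K #>\<^bsub>?F\<^esub> f"
    by (auto simp: tensor_group_def FactGroup_def RCOSETS_def)
  have "f + f \<in> ?K"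
  proof (rule free_Abelian_group_induct[of f ?S])
    show "Poly_Mapping.keys f \<subseteq> ?S" using f by simp
    show "0 + 0 \<in> ?K" using N.one_closed by simp
    show "a - b + (a - b) \<in> ?K" if ab: "a + a \<in> ?K" "b + b \<in> ?K" for a b
    proof -
      have "- (b + b) \<in> ?K"
        using N.m_inv_closed[OF ab(2)] N.subset ab(2) by auto
      from N.m_closed[OF ab(1) this] show ?thesis by (simp add: algebra_simps)
    qed
    show "frag_of a + frag_of a \<in> ?K" if "a \<in> ?S" for a
      using that tensor_kernel_double[OF assms(1)] by auto
  qed
  then have "?K #>\<^bsub>?F\<^esub> (f + f) = ?K"
    by (intro F.coset_join2 K) (use N.subset in blast)+
  with f show ?thesis
    using N.rcos_sum[OF f(1) f(1)] by (simp add: tensor_group_def FactGroup_def)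
qed

lemma vectorspace_milnor_mod2: "vectorspace F2 (milnor_mod2 n L)"
  unfolding milnor_mod2_def
  by (intro vectorspace_F2_space comm_group_tensor_group tensor_F2_exponent
      comm_group_milnor_quotient comm_group.axioms(2) comm_group_F2)

text \<open>Scalars act through the second tensor factor.\<close>

lemma F2_space_smult_pure_tensor:
  assumes "comm_group G" "g \<in> carrier G" "s \<in> carrier F2" "c \<in> carrier F2"
  shows "c \<odot>\<^bsub>F2_space (tensor_group G (add_monoid F2))\<^esub> pure_tensor G (add_monoid F2) g s
       = pure_tensor G (add_monoid F2) g (c \<otimes>\<^bsub>F2\<^esub> s)"
proof -
  let ?H = "add_monoid F2"
  let ?F = "free_Abelian_group (carrier G \<times> carrier ?H)"
  let ?K = "tensor_kernel G ?H"
  interpret G: comm_group G by fact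
  interpret H: comm_group ?H by (rule comm_group_F2)
  interpret F: comm_group ?F by (rule abelian_free_Abelian_group)
  have K: "subgroup ?K ?F"
    by (intro tensor_kernel_subgroup G.is_group H.is_group)
  interpret T: comm_group "tensor_group G ?H"
    by (intro comm_group_tensor_group G.is_group H.is_group)
  have one: "\<one>\<^bsub>tensor_group G ?H\<^esub> = ?K" by (simp add: tensor_group_def FactGroup_def)
  have zero: "pure_tensor G ?H g 0 = ?K"
    unfolding pure_tensor_def
    by (intro F.coset_join2 K tensor_kernel_zero[of _ _ 0] assms(1,2))
       (use assms(2) in \<open>auto simp: carrier_F2\<close>)
  have "pure_tensor G ?H g s \<in> carrier (tensor_group G ?H)"
    using assms(2,3) by (auto simp: pure_tensor_def tensor_group_def FactGroup_def RCOSETS_def)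
  then have "pure_tensor G ?H g s [^]\<^bsub>tensor_group G ?H\<^esub> (1::int) = pure_tensor G ?H g s"
    by (rule T.int_pow_1)
  moreover have "s = 0 \<or> s = 1" "c = 0 \<or> c = 1"
    using assms(3,4) by (auto simp only: carrier_F2)
  ultimately show ?thesis
    using zero one by (auto simp only: F2_space_def module.simps F2_simps) (simp_all add: one)
qed

end

theory Submission
  imports Defs
begin

text \<open>
  Reducing the exterior cube modulo two turns it into the space of bit vectors indexed by the
  triples \<open>a < b < c < n\<close>, so \<open>\<M>(\<Lambda>) \<otimes> \<int>/2\<close> is the quotient of that space by the span of the
  vectors \<open>v\<^sub>j\<^sub>k\<close> modulo two. Its dimension is therefore the corank over \<open>\<int>/2\<close> of an explicit
  matrix. The tables for \<open>n = 4, 5, 6\<close> then are a finite count over all \<open>2^(n choose 2)\<close> symmetric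
  0/1 matrices, carried out inside the logic by rewriting.

  The reduction to a corank goes through cardinalities instead of bases. The number of elements of
  a finite vector space over \<open>\<int>/2\<close> determines its dimension
  (\<open>card_carrier_eq_power_dim\<close>), and for abelian groups \<open>V \<le> G\<close> the group \<open>(G/V) \<otimes> \<int>/2\<close> is
  isomorphic to \<open>(G/2G)\<close> modulo the image of \<open>V\<close> (\<open>card_tensor_quotient_F2\<close>). Lagrange's theorem turns
  the latter into a quotient of two powers of two, and Gaussian elimination, which inserts one vector
  after the other into an echelon basis, computes the number of elements of the span
  (\<open>card_generate_rows\<close>). Together this is \<open>dim_milnor_mod2\<close>.

  The count exploits that \<open>v\<^sub>j\<^sub>k\<close> depends on \<open>\<Lambda>\<close> only through its column \<open>k\<close>. The matrices are
  enumerated as a tree: level \<open>k\<close> chooses the entries of column \<open>k\<close> that symmetry has not yet fixed,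
  and the vectors \<open>v\<^sub>j\<^sub>k\<close> are inserted there once for all matrices below that node. The shape of
  the tree also gives the total number of matrices (\<open>card_binary_linking_matrices\<close>). The leaves are
  tallied by corank (\<open>histogram_nth\<close>). For \<open>n = 6\<close> there are 32768 leaves with 30 vectors of length
  20 each; sharing the elimination along the tree keeps the evaluation by kernel rewriting within
  reach.
\<close>

section \<open>Vectors over the field with two elements\<close>

fun xor_vec :: "bool list \<Rightarrow> bool list \<Rightarrow> bool list" where
  "xor_vec (x # xs) (y # ys) = (if x then \<not> y else y) # xor_vec xs ys"
| "xor_vec _ _ = []"

lemma length_xor [simp]: "length (xor_vec u v) = min (length u) (length v)"
  by (induction u v rule: xor_vec.induct) auto

lemma xor_assoc: "xor_vec (xor_vec u v) w = xor_vec u (xor_vec v w)"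
proof (induction u v arbitrary: w rule: xor_vec.induct)
  case (1 x xs y ys) then show ?case by (cases w) auto
qed auto

lemma xor_commute: "xor_vec u v = xor_vec v u"
  by (induction u v rule: xor_vec.induct) auto

lemma xor_cancel: "length u = length v \<Longrightarrow> xor_vec u (xor_vec u v) = v"
  by (induction u v rule: xor_vec.induct) auto

lemma xor_zero: "length v = m \<Longrightarrow> xor_vec (replicate m False) v = v"
  by (induction v arbitrary: m) auto

definition xor_group :: "nat \<Rightarrow> bool list monoid" where
  "xor_group m = \<lparr>carrier = {v. length v = m}, monoid.mult = xor_vec, one = replicate m False\<rparr>"

lemma xor_group_simps [simp]:
  "carrier (xor_group m) = {v. length v = m}" "monoid.mult (xor_group m) = xor_vec"
  "\<one>\<^bsub>xor_group m\<^esub> = replicate m False"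
  by (simp_all add: xor_group_def)

lemma xor_self: "xor_vec v v = replicate (length v) False"
  by (induction v) auto

lemma comm_group_xor_group: "comm_group (xor_group m)"
  by (rule comm_groupI) (auto simp: xor_assoc xor_zero intro: xor_commute xor_self exI[of _ "_ :: bool list"])

lemma order_xor_group: "order (xor_group m) = 2 ^ m"
  using card_lists_length_eq[of "UNIV :: bool set" m] by (simp add: order_def)

text \<open>One step of building a span over \<open>\<int>/2\<close>: the only multiples of \<open>v\<close> are \<open>\<one>\<close> and \<open>v\<close>, and the
  union on the right is already closed under products because \<open>v \<otimes> v = \<one>\<close>.\<close>
lemma (in comm_group) generate_insert_involution:
  assumes v: "v \<in> carrier G" and S: "S \<subseteq> carrier G" and vv: "v \<otimes> v = \<one>"
  shows "generate G (insert v S) = generate G S \<union> (\<otimes>) v ` generate G S" (is "?L = ?R")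
proof
  have inS: "generate G S \<subseteq> carrier G" using generate_incl[OF S] .
  show "?R \<subseteq> ?L"
    using mono_generate[of S "insert v S"] by (auto intro: generate.intros)
  show "?L \<subseteq> ?R"
  proof
    fix x assume "x \<in> ?L"
    then show "x \<in> ?R"
    proof induction
      case one show ?case by (simp add: generate.one)
    next
      case (incl h)
      then show ?case using v generate.one[of G S] by (force intro: generate.incl)
    next
      case (inv h)
      have "inv v = v" using v vv inv_equality by blast
      then show ?case using inv v generate.one[of G S] by (force intro: generate.inv)
    next
      case (eng a b)
      have 1: "v \<otimes> s \<otimes> t = v \<otimes> (s \<otimes> t)" "s \<otimes> (v \<otimes> t) = v \<otimes> (s \<otimes> t)" "v \<otimes> s \<otimes> (v \<otimes> t) = s \<otimes> t"
        if "s \<in> generate G S" "t \<in> generate G S" for s t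
      proof -
        have c: "s \<in> carrier G" "t \<in> carrier G" using that inS by auto
        show "v \<otimes> s \<otimes> t = v \<otimes> (s \<otimes> t)" "s \<otimes> (v \<otimes> t) = v \<otimes> (s \<otimes> t)"
          using c v by (simp_all add: m_ac)
        have "v \<otimes> s \<otimes> (v \<otimes> t) = (v \<otimes> v) \<otimes> (s \<otimes> t)" using c v by (simp add: m_ac)
        then show "v \<otimes> s \<otimes> (v \<otimes> t) = s \<otimes> t" using c vv by simp
      qed
      show ?case using eng.IH
        by (auto simp: 1 intro: generate.eng)
    qed
  qed
qed

section \<open>Incremental Gaussian elimination\<close>

text \<open>An echelon basis is a list with one slot per column. The slot of a column is \<open>None\<close> if the
  column is free; otherwise it holds a basis vector whose leading one sits in that column, of which
  only the entries to the right are stored. Inserting a vector scans it from the left and clears each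
  leading one that meets an occupied slot.\<close>
type_synonym echelon_basis = "bool list option list"

fun insert_row :: "bool list \<Rightarrow> echelon_basis \<Rightarrow> echelon_basis" where
  "insert_row (False # xs) (b # bs) = b # insert_row xs bs"
| "insert_row (True # xs) (None # bs) = Some xs # bs"
| "insert_row (True # xs) (Some p # bs) = Some p # insert_row (xor_vec p xs) bs"
| "insert_row _ _ = []"

fun echelon :: "echelon_basis \<Rightarrow> bool" where
  "echelon [] \<longleftrightarrow> True"
| "echelon (b # bs) \<longleftrightarrow> (\<forall>p. b = Some p \<longrightarrow> length p = length bs) \<and> echelon bs"

text \<open>The subspace spanned by an echelon basis, by recursion on the first column: its entry can be
  nonzero only through the basis vector \<open>True # p\<close>. This form makes the number of elements
  immediate.\<close>
fun echelon_span :: "echelon_basis \<Rightarrow> bool list set" where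
  "echelon_span [] = {[]}"
| "echelon_span (None # bs) = (#) False ` echelon_span bs"
| "echelon_span (Some p # bs) =
     (#) False ` echelon_span bs \<union> (\<lambda>x. True # xor_vec p x) ` echelon_span bs"

definition corank :: "echelon_basis \<Rightarrow> nat" where
  "corank bs = length (filter (\<lambda>b. b = None) bs)"

lemma echelon_insert_row:
  "length v = length bs \<Longrightarrow> echelon bs \<Longrightarrow>
     echelon (insert_row v bs) \<and> length (insert_row v bs) = length bs"
  by (induction v bs rule: insert_row.induct) auto

lemma length_echelon_span: "echelon bs \<Longrightarrow> x \<in> echelon_span bs \<Longrightarrow> length x = length bs"
  by (induction bs arbitrary: x rule: echelon_span.induct) auto

lemma card_echelon_span:
  "echelon bs \<Longrightarrow> finite (echelon_span bs) \<and> card (echelon_span bs) * 2 ^ corank bs = 2 ^ length bs"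
proof (induction bs rule: echelon_span.induct)
  case (3 p bs)
  let ?S = "echelon_span bs"
  from 3 have p: "length p = length bs" and fin: "finite ?S" by auto
  have "inj_on (\<lambda>x. True # xor_vec p x) ?S"
  proof (rule inj_onI)
    fix x y assume xy: "x \<in> ?S" "y \<in> ?S" and "True # xor_vec p x = True # xor_vec p y"
    then have "xor_vec p (xor_vec p x) = xor_vec p (xor_vec p y)" by simp
    then show "x = y" using xor_cancel[of p x] xor_cancel[of p y] length_echelon_span[of bs] xy 3 by simp
  qed
  then have "card (echelon_span (Some p # bs)) = 2 * card ?S"
    using fin by (simp, subst card_Un_disjoint) (auto simp: card_image)
  then show ?case using 3 by (simp add: corank_def)
qed (auto simp: corank_def card_image)

text \<open>Clearing a leading one replaces \<open>v\<close> by \<open>v + b\<close> with \<open>b\<close> already in the span, so the coset of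
  \<open>v\<close> does not change.\<close>
lemma echelon_span_insert_row:
  "length v = length bs \<Longrightarrow> echelon bs \<Longrightarrow>
     echelon_span (insert_row v bs) = echelon_span bs \<union> xor_vec v ` echelon_span bs"
proof (induction v bs rule: insert_row.induct)
  case (1 xs b bs)
  show ?case
  proof (cases b)
    case None then show ?thesis using 1 by (auto simp: image_Un image_image)
  next
    case (Some p)
    have *: "xor_vec p (xor_vec xs x) = xor_vec xs (xor_vec p x)" for x
      by (metis xor_assoc xor_commute)
    show ?thesis using 1 Some by (simp add: image_Un image_image * Un_ac)
  qed
next
  case (2 xs bs)
  then show ?case by (simp add: image_image)
next
  case (3 xs p bs)
  have len: "length xs = length bs" "length p = length bs" using 3 by auto
  have *: "xor_vec p (xor_vec (xor_vec p xs) x) = xor_vec xs x" if "x \<in> echelon_span bs" for x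
    using that len 3 length_echelon_span[of bs x] by (simp add: xor_assoc xor_cancel)
  have **: "xor_vec xs (xor_vec p x) = xor_vec (xor_vec p xs) x" for x
    by (metis xor_assoc xor_commute)
  show ?case using 3 len
    by (simp add: image_Un image_image * ** Un_ac cong: image_cong_simp)
qed auto

lemma echelon_span_replicate_None: "echelon_span (replicate m None) = {replicate m False}"
  by (induction m) auto

lemma echelon_fold_insert_row:
  assumes "\<forall>v\<in>set vs. length v = m"
  shows "echelon (fold insert_row vs (replicate m None))
    \<and> length (fold insert_row vs (replicate m None)) = m
    \<and> echelon_span (fold insert_row vs (replicate m None)) = generate (xor_group m) (set vs)"
  using assms
proof (induction vs rule: rev_induct)
  case Nil
  interpret comm_group "xor_group m" by (rule comm_group_xor_group)
  have "echelon (replicate m None)" by (induction m) auto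
  then show ?case using generate_empty by (simp add: echelon_span_replicate_None)
next
  case (snoc v vs)
  interpret comm_group "xor_group m" by (rule comm_group_xor_group)
  show ?case using snoc generate_insert_involution[of v "set vs"]
    by (simp add: echelon_insert_row echelon_span_insert_row xor_self subset_iff)
qed

corollary card_generate_rows:
  assumes "\<forall>v\<in>set vs. length v = m"
  shows "card (generate (xor_group m) (set vs)) * 2 ^ corank (fold insert_row vs (replicate m None)) = 2 ^ m"
  using card_echelon_span echelon_fold_insert_row[OF assms] by metis

section \<open>Tensoring a quotient with the field of two elements\<close>

lemma (in vectorspace) card_carrier_eq_power_dim:
  assumes fin: "finite (carrier V)"
  shows "card (carrier V) = card (carrier K) ^ dim"
proof -
  have "gen_set (carrier V)"
    using in_own_span[of "carrier V"] span_is_subset2[of "carrier V"] by blast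
  then have fd: fin_dim unfolding fin_dim_def using fin by blast
  then obtain B where B: "finite B" "basis B" using finite_basis_exists by blast
  then have BV: "B \<subseteq> carrier V" by (simp add: basis_def)
  have "bij_betw (\<lambda>a. lincomb a B) (B \<rightarrow>\<^sub>E carrier K) (carrier V)"
  proof (rule bij_betw_imageI)
    have uniq: "\<exists>!a. a \<in> B \<rightarrow>\<^sub>E carrier K \<and> lincomb a B = v" if "v \<in> carrier V" for v
      using basis_criterion[OF B(1) BV] B(2) that by blast
    have closed: "lincomb a B \<in> carrier V" if "a \<in> B \<rightarrow>\<^sub>E carrier K" for a
      using that BV by (intro lincomb_closed) auto
    show "inj_on (\<lambda>a. lincomb a B) (B \<rightarrow>\<^sub>E carrier K)"
      using uniq closed by (intro inj_onI) metis
    show "(\<lambda>a. lincomb a B) ` (B \<rightarrow>\<^sub>E carrier K) = carrier V"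
      using uniq closed by blast
  qed
  then have "card (carrier V) = card (B \<rightarrow>\<^sub>E carrier K)" by (simp add: bij_betw_same_card)
  also have "\<dots> = card (carrier K) ^ card B" by (simp add: card_PiE B(1))
  finally show ?thesis using dim_basis[OF B] by simp
qed

text \<open>Here \<open>\<rho>\<close> is the reduction \<open>G \<rightarrow> G/2G\<close>, given abstractly: it is onto, its target has exponent two
  and its kernel consists of doubles. Sending \<open>(V + x) \<otimes> s\<close> to \<open>s \<cdot> \<rho> x\<close> modulo \<open>\<rho> V\<close> is
  bilinear, so it factors through the tensor product. It is injective there since, modulo the tensor
  relations, each element is a single pure tensor \<open>C \<otimes> 1\<close>, and \<open>C\<close> is mapped to zero only if it is
  a double. The cardinality of the target is given by Lagrange's theorem.\<close>
lemma card_tensor_quotient_F2: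
  assumes G: "comm_group G" and V: "subgroup V G" and B: "comm_group B"
    and rho: "\<rho> \<in> hom G B" "\<rho> ` carrier G = carrier B"
    and ker: "\<And>x. x \<in> carrier G \<Longrightarrow> \<rho> x = \<one>\<^bsub>B\<^esub> \<Longrightarrow> \<exists>y\<in>carrier G. x = y \<otimes>\<^bsub>G\<^esub> y"
    and exp2: "\<And>b. b \<in> carrier B \<Longrightarrow> b \<otimes>\<^bsub>B\<^esub> b = \<one>\<^bsub>B\<^esub>"
  shows "card (carrier (tensor_group (G Mod V) (add_monoid F2))) * card (\<rho> ` V) = order B"
proof -
  let ?H = "add_monoid F2" and ?M = "G Mod V" and ?W = "\<rho> ` V"
  let ?Q = "B Mod ?W"
  let ?S = "carrier ?M \<times> carrier ?H"
  let ?F = "free_Abelian_group ?S"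
  let ?K = "tensor_kernel ?M ?H"
  interpret G: comm_group G by fact
  interpret B: comm_group B by fact
  interpret H: comm_group ?H by (rule comm_group_F2)
  interpret V: normal V G by (rule G.subgroup_imp_normal[OF V])
  interpret \<rho>: group_hom G B \<rho>
    by (intro group_hom.intro group_hom_axioms.intro G.is_group B.is_group rho)
  have W: "subgroup ?W B" by (rule \<rho>.subgroup_img_is_subgroup[OF V])
  interpret W: normal ?W B by (rule B.subgroup_imp_normal[OF W])
  interpret M: comm_group ?M by (rule G.abelian_FactGroup[OF V])
  interpret Q: comm_group ?Q by (rule B.abelian_FactGroup[OF W])
  interpret F: comm_group ?F by (rule abelian_free_Abelian_group)
  have K: "subgroup ?K ?F"
    by (intro tensor_kernel_subgroup M.is_group H.is_group)
  have HC: "carrier ?H = {0, 1}" by (simp add: carrier_F2)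
  have Q2: "q \<otimes>\<^bsub>?Q\<^esub> q = \<one>\<^bsub>?Q\<^esub>" if q: "q \<in> carrier ?Q" for q
  proof -
    obtain b where b: "b \<in> carrier B" "q = ?W #>\<^bsub>B\<^esub> b" using q by (auto simp: carrier_FactGroup)
    then have "q \<otimes>\<^bsub>?Q\<^esub> q = ?W #>\<^bsub>B\<^esub> (b \<otimes>\<^bsub>B\<^esub> b)" by (simp add: W.rcos_sum)
    then show ?thesis using b exp2 by (simp add: B.coset_join2 W W.subset B.coset_mult_one)
  qed

  have comm_id: "p \<otimes>\<^bsub>?Q\<^esub> q \<otimes>\<^bsub>?Q\<^esub> inv\<^bsub>?Q\<^esub> p \<otimes>\<^bsub>?Q\<^esub> inv\<^bsub>?Q\<^esub> q = \<one>\<^bsub>?Q\<^esub>"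
    if "p \<in> carrier ?Q" "q \<in> carrier ?Q" for p q
  proof -
    have "p \<otimes>\<^bsub>?Q\<^esub> q \<otimes>\<^bsub>?Q\<^esub> inv\<^bsub>?Q\<^esub> p = q"
      using that by (metis Q.inv_closed Q.m_assoc Q.m_comm Q.r_inv Q.r_one)
    then show ?thesis using that Q.r_inv by metis
  qed

  \<comment> \<open>The map \<open>h\<close> is \<open>\<rho>\<close> read modulo \<open>V\<close> and its image \<open>\<rho> V\<close>; \<open>\<theta>\<close> extends \<open>(C, s) \<mapsto> s \<cdot> h C\<close>
    additively to formal sums of pairs.\<close>
  have "(\<lambda>x. ?W #>\<^bsub>B\<^esub> \<rho> x) \<in> hom G ?Q"
    using W.r_coset_hom_Mod rho(1) hom_compose[of \<rho> G B "\<lambda>b. ?W #>\<^bsub>B\<^esub> b" ?Q]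
    by (simp add: comp_def)
  moreover have "?W #>\<^bsub>B\<^esub> \<rho> x = ?W #>\<^bsub>B\<^esub> \<rho> y"
    if xy: "x \<in> carrier G" "y \<in> carrier G" "V #>\<^bsub>G\<^esub> x = V #>\<^bsub>G\<^esub> y" for x y
  proof -
    have "x \<in> V #>\<^bsub>G\<^esub> y" using xy G.rcos_self[OF xy(1) V] by simp
    then obtain v where v: "v \<in> V" "x = v \<otimes>\<^bsub>G\<^esub> y" by (auto simp: r_coset_def)
    then have "\<rho> x \<in> ?W #>\<^bsub>B\<^esub> \<rho> y" using xy V.subset by (auto simp: r_coset_def)
    then show ?thesis using B.repr_independence[OF _ \<rho>.hom_closed[OF xy(2)] W] by simp
  qed
  ultimately obtain h where h: "h \<in> hom ?M ?Q"
    and hV: "\<And>x. x \<in> carrier G \<Longrightarrow> h (V #>\<^bsub>G\<^esub> x) = ?W #>\<^bsub>B\<^esub> \<rho> x"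
    by (rule FactGroup_universal[OF _ V.normal_axioms]) auto
  interpret h: group_hom ?M ?Q h
    by (intro group_hom.intro group_hom_axioms.intro M.is_group Q.is_group h)

  define f where "f = (\<lambda>(C, s::int). if s = 0 then \<one>\<^bsub>?Q\<^esub> else h C)"
  have f_0: "f (C, 0) = \<one>\<^bsub>?Q\<^esub>" and f_nonzero: "s \<noteq> 0 \<Longrightarrow> f (C, s) = h C" for C s
    by (simp_all add: f_def)
  have "f ` ?S \<subseteq> carrier ?Q" using Q.one_closed by (auto simp: f_def)
  then obtain \<theta> where \<theta>: "\<theta> \<in> hom ?F ?Q" and \<theta>_of: "\<And>z. z \<in> ?S \<Longrightarrow> \<theta> (frag_of z) = f z"
    using Q.free_Abelian_group_universal by blast
  interpret \<theta>: group_hom ?F ?Q \<theta>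
    by (intro group_hom.intro group_hom_axioms.intro F.is_group Q.is_group \<theta>)
  have \<theta>_add: "\<theta> (a + b) = \<theta> a \<otimes>\<^bsub>?Q\<^esub> \<theta> b" if "a \<in> carrier ?F" "b \<in> carrier ?F" for a b
    using \<theta>.hom_mult[OF that] by simp
  have \<theta>_diff: "\<theta> (a - b) = \<theta> a \<otimes>\<^bsub>?Q\<^esub> inv\<^bsub>?Q\<^esub> \<theta> b" if "a \<in> carrier ?F" "b \<in> carrier ?F" for a b
    using \<theta>_add[of a "- b"] \<theta>.hom_inv[OF that(2)] that by simp
  have closed: "a + b \<in> carrier ?F" "a - b \<in> carrier ?F" "- a \<in> carrier ?F"
    if "a \<in> carrier ?F" "b \<in> carrier ?F" for a b
    using F.m_closed[OF that] F.m_closed[OF that(1) F.inv_closed[OF that(2)]] F.inv_closed[OF that(1)] that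
    by simp_all

  have "\<theta> ` carrier ?F = carrier ?Q"
  proof
    show "carrier ?Q \<subseteq> \<theta> ` carrier ?F"
    proof
      fix q assume "q \<in> carrier ?Q"
      then obtain x where x: "x \<in> carrier G" "q = ?W #>\<^bsub>B\<^esub> \<rho> x"
        unfolding carrier_FactGroup rho(2)[symmetric] by blast
      let ?z = "(V #>\<^bsub>G\<^esub> x, 1::int)"
      have "?z \<in> ?S" using x by (auto simp: carrier_FactGroup carrier_F2)
      moreover from this have "\<theta> (frag_of ?z) = q" using x \<theta>_of hV by (simp add: f_def)
      ultimately show "q \<in> \<theta> ` carrier ?F" by (metis frag_of_in_free_Abelian_group image_eqI)
    qed
  qed auto

  moreover have K_sub: "?K \<subseteq> kernel ?F ?Q \<theta>"
  proof -
    have "r \<in> kernel ?F ?Q \<theta>" if r: "r \<in> tensor_relations ?M ?H" for r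
      using r unfolding tensor_relations_def
    proof (elim UnE CollectE exE conjE)
      fix C C' s assume r: "r = frag_of (C \<otimes>\<^bsub>?M\<^esub> C', s) - frag_of (C, s) - frag_of (C', s)"
        and C: "C \<in> carrier ?M" "C' \<in> carrier ?M" and s: "s \<in> carrier ?H"
      have S: "(C \<otimes>\<^bsub>?M\<^esub> C', s) \<in> ?S" "(C, s) \<in> ?S" "(C', s) \<in> ?S"
        using C s M.m_closed[OF C] by simp_all
      then have "\<theta> r = f (C \<otimes>\<^bsub>?M\<^esub> C', s) \<otimes>\<^bsub>?Q\<^esub> inv\<^bsub>?Q\<^esub> f (C, s) \<otimes>\<^bsub>?Q\<^esub> inv\<^bsub>?Q\<^esub> f (C', s)"
        unfolding r by (simp only: \<theta>_diff \<theta>_of closed frag_of_in_free_Abelian_group)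
      also have "\<dots> = \<one>\<^bsub>?Q\<^esub>"
      proof (cases "s = 0")
        case True
        then show ?thesis by (simp only: f_0 Q.inv_one Q.r_one Q.one_closed)
      next
        case False
        then show ?thesis
          using comm_id[OF h.hom_closed[OF C(1)] h.hom_closed[OF C(2)]]
          by (simp only: f_nonzero[OF False] h.hom_mult[OF C])
      qed
      finally show ?thesis
        using S unfolding kernel_def r by (simp only: closed frag_of_in_free_Abelian_group mem_Collect_eq)
    next
      fix C s s' assume r: "r = frag_of (C, s \<otimes>\<^bsub>?H\<^esub> s') - frag_of (C, s) - frag_of (C, s')"
        and C: "C \<in> carrier ?M" and s: "s \<in> carrier ?H" "s' \<in> carrier ?H"
      have S: "(C, s \<otimes>\<^bsub>?H\<^esub> s') \<in> ?S" "(C, s) \<in> ?S" "(C, s') \<in> ?S"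
        using C s H.m_closed[OF s] by simp_all
      then have "\<theta> r = f (C, s \<otimes>\<^bsub>?H\<^esub> s') \<otimes>\<^bsub>?Q\<^esub> inv\<^bsub>?Q\<^esub> f (C, s) \<otimes>\<^bsub>?Q\<^esub> inv\<^bsub>?Q\<^esub> f (C, s')"
        unfolding r by (simp only: \<theta>_diff \<theta>_of closed frag_of_in_free_Abelian_group)
      also have "\<dots> = \<one>\<^bsub>?Q\<^esub>"
      proof -
        have hC: "h C \<in> carrier ?Q" using C by simp
        have inv: "inv\<^bsub>?Q\<^esub> h C = h C" using Q.inv_equality[OF Q2[OF hC] hC hC] .
        have plus: "(0::int) \<otimes>\<^bsub>?H\<^esub> 0 = 0" "(0::int) \<otimes>\<^bsub>?H\<^esub> 1 = 1"
          "(1::int) \<otimes>\<^bsub>?H\<^esub> 0 = 1" "(1::int) \<otimes>\<^bsub>?H\<^esub> 1 = 0"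
          by (simp_all add: F2_simps)
        have "s = 0 \<or> s = 1" "s' = 0 \<or> s' = 1" using s HC by auto
        then show ?thesis
          by (elim disjE; simp only: plus f_0 f_nonzero[OF one_neq_zero] inv Q.inv_one
              Q.r_one Q.l_one Q.one_closed Q2[OF hC] hC)
      qed
      finally show ?thesis
        using S unfolding kernel_def r by (simp only: closed frag_of_in_free_Abelian_group mem_Collect_eq)
    qed
    then show ?thesis
      unfolding tensor_kernel_def by (intro F.generate_subgroup_incl \<theta>.subgroup_kernel subsetI)
  qed

  moreover have "kernel ?F ?Q \<theta> \<subseteq> ?K"
  proof -
    have K_add: "a + b \<in> ?K" if "a \<in> ?K" "b \<in> ?K" for a b
      using subgroup.m_closed[OF K that] by simp
    have K_minus: "- a \<in> ?K" if "a \<in> ?K" for a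
      using subgroup.m_inv_closed[OF K that] subgroup.mem_carrier[OF K that] by simp
    have K_diff: "a - b \<in> ?K" if "a \<in> ?K" "b \<in> ?K" for a b
      using K_add[OF that(1) K_minus[OF that(2)]] by simp
    have rel: "frag_of (C \<otimes>\<^bsub>?M\<^esub> C', 1) - frag_of (C, 1) - frag_of (C', 1) \<in> ?K"
      if "C \<in> carrier ?M" "C' \<in> carrier ?M" for C C'
      unfolding tensor_kernel_def
      by (rule generate.incl) (use that carrier_F2 in \<open>auto simp: tensor_relations_def\<close>)
    have dbl: "frag_of (C, 1) + frag_of (C, 1) \<in> ?K" if "C \<in> carrier ?M" for C
      using tensor_kernel_double[OF M.comm_group_axioms that, of 1] by (simp add: carrier_F2)
    have zero: "frag_of (C, 0) \<in> ?K" if "C \<in> carrier ?M" for C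
      using tensor_kernel_zero[OF M.comm_group_axioms that, of 0] by (simp add: carrier_F2)
    have one: "frag_of (\<one>\<^bsub>?M\<^esub>, 1) \<in> ?K"
      using K_minus[OF rel[OF M.one_closed M.one_closed]] by (simp del: one_FactGroup mult_FactGroup)
    \<comment> \<open>Every formal sum is congruent to one pure tensor: sums of pure tensors \<open>C \<otimes> 1\<close> merge by
      additivity in the first factor, and differences are sums because doubles vanish.\<close>
    have rep: "\<exists>C\<in>carrier ?M. a - frag_of (C, 1) \<in> ?K" if a: "Poly_Mapping.keys a \<subseteq> ?S" for a
      using a
    proof (rule free_Abelian_group_induct)
      show "\<exists>C\<in>carrier ?M. 0 - frag_of (C, 1) \<in> ?K"
        using K_minus[OF one] M.one_closed by auto
    next
      fix x y assume "\<exists>C\<in>carrier ?M. x - frag_of (C, 1) \<in> ?K" "\<exists>C\<in>carrier ?M. y - frag_of (C, 1) \<in> ?K"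
      then obtain C D where C: "C \<in> carrier ?M" "x - frag_of (C, 1) \<in> ?K"
        and D: "D \<in> carrier ?M" "y - frag_of (D, 1) \<in> ?K" by blast
      have "x - y - frag_of (C \<otimes>\<^bsub>?M\<^esub> D, 1) =
          (x - frag_of (C, 1)) - (y - frag_of (D, 1))
          - (frag_of (C \<otimes>\<^bsub>?M\<^esub> D, 1) - frag_of (C, 1) - frag_of (D, 1))
          - (frag_of (D, 1) + frag_of (D, 1))" by simp
      also have "\<dots> \<in> ?K" by (intro K_diff rel dbl C D)
      finally show "\<exists>C\<in>carrier ?M. x - y - frag_of (C, 1) \<in> ?K" using C D M.m_closed by blast
    next
      fix z assume z: "z \<in> ?S"
      then obtain C s where Cs: "z = (C, s)" "C \<in> carrier ?M" "s = 0 \<or> s = 1"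
        by (auto simp: carrier_F2)
      show "\<exists>C\<in>carrier ?M. frag_of z - frag_of (C, 1) \<in> ?K"
        using Cs(3)
      proof
        assume "s = 0"
        then show ?thesis using Cs K_diff[OF zero one] M.one_closed by blast
      next
        assume "s = 1"
        then have "frag_of z - frag_of (C, 1) \<in> ?K" using Cs subgroup.one_closed[OF K] by simp
        then show ?thesis using Cs by blast
      qed
    qed
    show ?thesis
    proof
      fix a assume "a \<in> kernel ?F ?Q \<theta>"
      then have a: "a \<in> carrier ?F" "\<theta> a = \<one>\<^bsub>?Q\<^esub>" by (auto simp: kernel_def)
      have "Poly_Mapping.keys a \<subseteq> ?S" using a(1) by (simp only: carrier_free_Abelian_group_iff)
      from rep[OF this] obtain C where C: "C \<in> carrier ?M" "a - frag_of (C, 1) \<in> ?K"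
        by (rule bexE)
      have CS: "(C, 1) \<in> ?S" using C by (simp add: carrier_F2)
      have "a - frag_of (C, 1) \<in> kernel ?F ?Q \<theta>" using C(2) K_sub by blast
      then have "\<theta> a \<otimes>\<^bsub>?Q\<^esub> inv\<^bsub>?Q\<^esub> f (C, 1) = \<one>\<^bsub>?Q\<^esub>"
        using a CS by (simp only: kernel_def mem_Collect_eq \<theta>_diff \<theta>_of frag_of_in_free_Abelian_group)
      then have hC: "h C = \<one>\<^bsub>?Q\<^esub>"
        using a(2) C(1) by (metis Q.inv_one Q.inv_inv Q.l_one Q.inv_closed f_nonzero h.hom_closed one_neq_zero)
      obtain x where x: "x \<in> carrier G" "C = V #>\<^bsub>G\<^esub> x" using C by (auto simp: carrier_FactGroup)
      have "?W #>\<^bsub>B\<^esub> \<rho> x = ?W" using hC hV x by simp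
      then have "\<rho> x \<in> ?W" using B.coset_join1[OF _ _ W] x W.subset by simp
      then obtain v where v: "v \<in> V" "\<rho> x = \<rho> v" by auto
      have vG: "v \<in> carrier G" using v V.subset by blast
      have "\<rho> (inv\<^bsub>G\<^esub> v \<otimes>\<^bsub>G\<^esub> x) = \<one>\<^bsub>B\<^esub>" using v vG x by simp
      from ker[OF G.m_closed[OF G.inv_closed[OF vG] x(1)] this]
      obtain y where y: "y \<in> carrier G" "inv\<^bsub>G\<^esub> v \<otimes>\<^bsub>G\<^esub> x = y \<otimes>\<^bsub>G\<^esub> y"
        by (rule bexE)
      have "v \<otimes>\<^bsub>G\<^esub> (inv\<^bsub>G\<^esub> v \<otimes>\<^bsub>G\<^esub> x) = x" using vG x(1)
        by (metis G.inv_closed G.l_one G.m_assoc G.r_inv)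
      then have "x = v \<otimes>\<^bsub>G\<^esub> (y \<otimes>\<^bsub>G\<^esub> y)" by (simp only: y(2))
      then have "x \<in> V #>\<^bsub>G\<^esub> (y \<otimes>\<^bsub>G\<^esub> y)" using v by (auto simp: r_coset_def)
      then have "C = V #>\<^bsub>G\<^esub> (y \<otimes>\<^bsub>G\<^esub> y)" using x y G.repr_independence[OF _ _ V] by blast
      then have D: "C = (V #>\<^bsub>G\<^esub> y) \<otimes>\<^bsub>?M\<^esub> (V #>\<^bsub>G\<^esub> y)" using y by (simp add: V.rcos_sum)
      let ?D = "V #>\<^bsub>G\<^esub> y"
      have DM: "?D \<in> carrier ?M" using y by (auto simp: carrier_FactGroup)
      have "a = (a - frag_of (C, 1)) + (frag_of (C, 1) - frag_of (?D, 1) - frag_of (?D, 1))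
          + (frag_of (?D, 1) + frag_of (?D, 1))" by simp
      also have "\<dots> \<in> ?K" using rel[OF DM DM] unfolding D[symmetric] by (intro K_add C dbl DM)
      finally show "a \<in> ?K" .
    qed
  qed

  ultimately have onto: "\<theta> ` carrier ?F = carrier ?Q" and ker_eq: "kernel ?F ?Q \<theta> = ?K"
    by (simp_all only: subset_antisym)
  have "(\<lambda>X. the_elem (\<theta> ` X)) \<in> iso (tensor_group ?M ?H) ?Q"
    unfolding tensor_group_def ker_eq[symmetric] by (rule \<theta>.FactGroup_iso_set[OF onto])
  then have "card (carrier (tensor_group ?M ?H)) = card (carrier ?Q)"
    by (auto simp: iso_def intro: bij_betw_same_card)
  also have "carrier ?Q = rcosets\<^bsub>B\<^esub> ?W" by (simp add: FactGroup_def)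
  finally show ?thesis using B.lagrange[OF W] by simp
qed

section \<open>The generators modulo two\<close>

text \<open>The order of the triples fixes the order of the columns in the elimination.\<close>
definition triple_list :: "nat \<Rightarrow> (nat \<times> nat \<times> nat) list" where
  "triple_list n =
     filter (\<lambda>(a, b, c). a < b \<and> b < c) (List.product [0..<n] (List.product [0..<n] [0..<n]))"

text \<open>The index \<open>i\<close> with \<open>{i, j, k} = {a, b, c}\<close>, if there is one.\<close>
fun third_vertex :: "nat \<Rightarrow> nat \<Rightarrow> nat \<times> nat \<times> nat \<Rightarrow> nat option" where
  "third_vertex j k (a, b, c) =
    (if (j, k) = (a, b) \<or> (j, k) = (b, a) then Some c else
     if (j, k) = (a, c) \<or> (j, k) = (c, a) then Some b else
     if (j, k) = (b, c) \<or> (j, k) = (c, b) then Some a else None)"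

lemma set_triple_list: "set (triple_list n) = triples n"
  by (auto simp: triple_list_def triples_def)

lemma distinct_triple_list: "distinct (triple_list n)"
  by (simp add: triple_list_def distinct_product)

definition parity_vec :: "nat \<Rightarrow> (nat \<times> nat \<times> nat \<Rightarrow>\<^sub>0 int) \<Rightarrow> bool list" where
  "parity_vec n x = map (\<lambda>t. odd (Poly_Mapping.lookup x t)) (triple_list n)"

lemma odd_minor3_unit_vec:
  assumes "(a, b, c) \<in> triples n" "i < n" "j < n" "k < n"
  shows "odd (minor3 (unit_vec n i) (unit_vec n j) (unit_vec n k) (a, b, c)) \<longleftrightarrow>
    third_vertex j k (a, b, c) = Some i"
  using assms by (auto simp: minor3_def triples_def)

lemma third_vertex_less:
  assumes "t \<in> triples n" "third_vertex j k t = Some i" shows "i < n"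
  using assms by (cases t) (auto simp: triples_def split: if_splits)

text \<open>Modulo two signs disappear, and \<open>X\<^sup>i\<^sup>j\<^sup>k\<close> becomes the indicator of the set \<open>{i, j, k}\<close>. For given
  \<open>j\<close>, \<open>k\<close> and triple at most one summand of \<open>v\<^sub>j\<^sub>k\<close> contributes.\<close>
lemma odd_lookup_v_elem:
  assumes t: "t \<in> triples n" and jk: "j < n" "k < n"
  shows "odd (Poly_Mapping.lookup (v_elem n L j k) t) \<longleftrightarrow>
    (case third_vertex j k t of None \<Rightarrow> False | Some i \<Rightarrow> odd (L $$ (i, k)))"
proof -
  obtain a b c where abc: "t = (a, b, c)" by (cases t)
  let ?m = "\<lambda>i. L $$ (i, k) * minor3 (unit_vec n i) (unit_vec n j) (unit_vec n k) t"
  have m: "odd (?m i) \<longleftrightarrow> odd (L $$ (i, k)) \<and> third_vertex j k t = Some i" if "i < n" for i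
    using odd_minor3_unit_vec[of a b c n i j k] t jk that by (simp add: abc)
  have "Poly_Mapping.lookup (v_elem n L j k) t = (\<Sum>i<n. ?m i)"
    using t by (simp add: v_elem_def X_def lookup_sum lookup_wedge3)
  moreover have "odd (\<Sum>i<n. ?m i) \<longleftrightarrow> odd (card {i \<in> {..<n}. odd (?m i)})"
    by (rule even_sum_iff[THEN arg_cong[of _ _ Not]]) simp
  moreover have "{i \<in> {..<n}. odd (?m i)} = {i. i < n \<and> odd (L $$ (i, k)) \<and> third_vertex j k t = Some i}"
    unfolding lessThan_iff using m by blast
  moreover have "{i. i < n \<and> odd (L $$ (i, k)) \<and> third_vertex j k t = Some i} =
      (case third_vertex j k t of None \<Rightarrow> {} | Some i \<Rightarrow> if odd (L $$ (i, k)) then {i} else {})"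
    using third_vertex_less[OF t] by (auto split: option.splits)
  ultimately show ?thesis by (auto split: option.splits)
qed

lemma parity_vec_hom: "parity_vec n \<in> hom (exterior_cube n) (xor_group (length (triple_list n)))"
proof -
  have "xor_vec (map f ts) (map g ts) = map (\<lambda>t. f t \<noteq> g t) ts"
    for f g and ts :: "(nat \<times> nat \<times> nat) list"
    by (induction ts) auto
  then show ?thesis
    by (auto simp: hom_def exterior_cube_def parity_vec_def lookup_add)
qed

lemma parity_vec_surj:
  "parity_vec n ` carrier (exterior_cube n) = carrier (xor_group (length (triple_list n)))"
proof
  show "carrier (xor_group (length (triple_list n))) \<subseteq> parity_vec n ` carrier (exterior_cube n)"
  proof
    fix v assume "v \<in> carrier (xor_group (length (triple_list n)))"
    then have len: "length v = length (triple_list n)" by simp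
    define f where "f = map_of (zip (triple_list n) v)"
    have f: "f (triple_list n ! i) = Some (v ! i)" if "i < length (triple_list n)" for i
      using that len by (simp add: f_def map_of_zip_nth distinct_triple_list)
    define x where "x = (\<Sum>t\<in>{t \<in> triples n. f t = Some True}. frag_of t)"
    have x: "Poly_Mapping.lookup x t = (if f t = Some True then 1 else 0)" if "t \<in> triples n" for t
      using that finite_triples by (simp add: x_def lookup_sum lookup_frag_of)
    have "parity_vec n x = v"
    proof (rule nth_equalityI)
      fix i assume "i < length (parity_vec n x)"
      then have i: "i < length (triple_list n)" by (simp add: parity_vec_def)
      then have "triple_list n ! i \<in> triples n" using set_triple_list nth_mem by metis
      then show "parity_vec n x ! i = v ! i" using i by (simp add: parity_vec_def x f)
    qed (simp add: parity_vec_def len)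
    moreover have "x \<in> carrier (exterior_cube n)"
      unfolding x_def exterior_cube_def by (rule sum_closed_free_Abelian_group) auto
    ultimately show "v \<in> parity_vec n ` carrier (exterior_cube n)" by blast
  qed
qed (auto simp: parity_vec_def)

lemma parity_vec_zero_imp_double:
  assumes x: "x \<in> carrier (exterior_cube n)"
    and zero: "parity_vec n x = replicate (length (triple_list n)) False"
  shows "\<exists>y\<in>carrier (exterior_cube n). x = y + y"
proof
  let ?y = "\<Sum>t\<in>triples n. frag_cmul (Poly_Mapping.lookup x t div 2) (frag_of t)"
  have y: "Poly_Mapping.lookup ?y t = (if t \<in> triples n then Poly_Mapping.lookup x t div 2 else 0)" for t
    by (simp add: lookup_sum finite_triples if_distrib cong: if_cong)
  have even: "even (Poly_Mapping.lookup x t)" if "t \<in> triples n" for t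
  proof -
    have "odd (Poly_Mapping.lookup x t) \<in> set (parity_vec n x)"
      using that by (auto simp: parity_vec_def set_triple_list)
    then show ?thesis unfolding zero by simp
  qed
  have out: "Poly_Mapping.lookup x t = 0" if "t \<notin> triples n" for t
    using x that by (auto simp: exterior_cube_def in_keys_iff)
  show "x = ?y + ?y"
    by (rule poly_mapping_eqI) (auto simp: lookup_add y out dest: even)
  show "?y \<in> carrier (exterior_cube n)"
    by (auto simp: exterior_cube_def in_keys_iff y split: if_splits)
qed

type_synonym pattern = "nat option list"

text \<open>The pattern of \<open>v\<^sub>j\<^sub>k\<close> modulo two is the same for all linking matrices: the coordinate at a
  triple is either zero or the entry of column \<open>k\<close> at a fixed position. Patterns are computed once,
  and \<open>fill_row\<close> evaluates one at a column \<open>u\<close>.\<close>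
fun fill_row :: "bool list \<Rightarrow> pattern \<Rightarrow> bool list" where
  "fill_row u [] = []"
| "fill_row u (None # ts) = False # fill_row u ts"
| "fill_row u (Some i # ts) = u ! i # fill_row u ts"

definition row_patterns :: "nat \<Rightarrow> nat \<Rightarrow> pattern list" where
  "row_patterns n k = map (\<lambda>j. map (third_vertex j k) (triple_list n)) (filter (\<lambda>j. j \<noteq> k) [0..<n])"

lemma fill_row_eq_map: "fill_row u ts = map (\<lambda>z. case z of None \<Rightarrow> False | Some i \<Rightarrow> u ! i) ts"
  by (induction u ts rule: fill_row.induct) auto

lemma parity_vec_v_elem:
  assumes "j < n" "k < n" and u: "\<And>i. i < n \<Longrightarrow> u ! i \<longleftrightarrow> odd (L $$ (i, k))"
  shows "parity_vec n (v_elem n L j k) = fill_row u (map (third_vertex j k) (triple_list n))"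
  using assms third_vertex_less[of _ n j k] set_triple_list
  by (auto simp: parity_vec_def fill_row_eq_map odd_lookup_v_elem split: option.splits)

section \<open>The dimension as a corank\<close>

definition insert_block :: "bool list \<Rightarrow> pattern list \<Rightarrow> echelon_basis \<Rightarrow> echelon_basis" where
  "insert_block u ts = fold (\<lambda>t. insert_row (fill_row u t)) ts"

definition insert_blocks ::
    "bool list list \<Rightarrow> pattern list list \<Rightarrow> echelon_basis \<Rightarrow> echelon_basis" where
  "insert_blocks M tss = fold (\<lambda>(u, ts). insert_block u ts) (zip M tss)"

lemma insert_block_eq: "insert_block u ts = fold insert_row (map (fill_row u) ts)"
  by (simp add: insert_block_def fold_map comp_def)

lemma insert_blocks_eq:
  "insert_blocks M tss = fold insert_row (concat (map2 (\<lambda>u ts. map (fill_row u) ts) M tss))"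
proof -
  have "fold (\<lambda>(u, ts). insert_block u ts) xs =
      fold insert_row (concat (map (\<lambda>(u, ts). map (fill_row u) ts) xs))" for xs
    by (induction xs) (auto simp: insert_block_eq)
  then show ?thesis by (simp add: insert_blocks_def)
qed

definition adjacency_rows :: "nat \<Rightarrow> int mat \<Rightarrow> bool list list" where
  "adjacency_rows n L = map (\<lambda>k. map (\<lambda>i. L $$ (i, k) = 1) [0..<n]) [0..<n]"

text \<open>All vectors \<open>v\<^sub>j\<^sub>k\<close> with the same \<open>k\<close> form one block, evaluated at the adjacency row of \<open>k\<close>.
  If \<open>m\<close> is the number of triples and \<open>r\<close> the number of free columns, the span has \<open>2\<^sup>m / 2\<^sup>r\<close>
  elements, so the tensor product has \<open>2\<^sup>r\<close>.\<close>
theorem dim_milnor_mod2: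
  assumes L: "L \<in> binary_linking_matrices n"
  shows "vectorspace.dim F2 (milnor_mod2 n L) =
    corank (insert_blocks (adjacency_rows n L) (map (row_patterns n) [0..<n])
      (replicate (length (triple_list n)) None))"
proof -
  let ?E = "exterior_cube n" and ?m = "length (triple_list n)"
  let ?B = "xor_group ?m"
  let ?gens = "{v_elem n L j k | j k. j < n \<and> k < n \<and> j \<noteq> k}"
  define vs where "vs = concat (map2 (\<lambda>u ts. map (fill_row u) ts)
      (adjacency_rows n L) (map (row_patterns n) [0..<n]))"
  interpret E: comm_group ?E by (rule comm_group_exterior_cube)
  interpret B: comm_group ?B by (rule comm_group_xor_group)
  interpret group_hom ?E ?B "parity_vec n"
    by (intro group_hom.intro group_hom_axioms.intro E.is_group B.is_group parity_vec_hom)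
  have gens: "?gens \<subseteq> carrier ?E" using v_elem_closed by blast
  have V: "subgroup (V_subgroup n L) ?E"
    unfolding V_subgroup_def by (rule E.generate_is_subgroup[OF gens])
  have "map2 (\<lambda>u ts. map (fill_row u) ts) (adjacency_rows n L) (map (row_patterns n) [0..<n])
      = map (\<lambda>k. map (fill_row (adjacency_rows n L ! k)) (row_patterns n k)) [0..<n]"
    by (rule nth_equalityI) (simp_all add: adjacency_rows_def)
  then have vs: "set vs = (\<Union>k<n. fill_row (adjacency_rows n L ! k) ` set (row_patterns n k))"
    unfolding vs_def by (simp only: set_concat set_map image_image) (simp add: atLeast0LessThan)
  have row: "parity_vec n (v_elem n L j k) =
      fill_row (adjacency_rows n L ! k) (map (third_vertex j k) (triple_list n))" if "j < n" "k < n" for j k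
  proof (rule parity_vec_v_elem[OF that])
    fix i assume "i < n"
    then have "L $$ (i, k) \<in> {0, 1}"
      using L that by (simp add: binary_linking_matrices_def)
    then show "adjacency_rows n L ! k ! i \<longleftrightarrow> odd (L $$ (i, k))"
      using \<open>i < n\<close> that by (auto simp: adjacency_rows_def)
  qed
  have "parity_vec n ` ?gens = set vs"
    unfolding vs row_patterns_def by (fastforce simp: row image_iff)
  then have span: "parity_vec n ` V_subgroup n L = generate ?B (set vs)"
    unfolding V_subgroup_def using generate_img[OF gens] by simp
  have len: "\<forall>v\<in>set vs. length v = ?m"
    unfolding vs by (auto simp: row_patterns_def fill_row_eq_map)
  let ?r = "corank (fold insert_row vs (replicate ?m None))"
  let ?A = "tensor_group (milnor_quotient n L) (add_monoid F2)"
  have "card (carrier ?A) * card (generate ?B (set vs)) = order ?B"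
    unfolding milnor_quotient_def span[symmetric]
  proof (rule card_tensor_quotient_F2[OF E.comm_group_axioms V B.comm_group_axioms
        parity_vec_hom parity_vec_surj])
    fix x assume "x \<in> carrier ?E" "parity_vec n x = \<one>\<^bsub>?B\<^esub>"
    then show "\<exists>y\<in>carrier ?E. x = y \<otimes>\<^bsub>?E\<^esub> y"
      using parity_vec_zero_imp_double[of x n] by (simp add: exterior_cube_def)
  qed (auto simp: xor_self)
  then have "card (carrier ?A) * card (generate ?B (set vs)) = card (generate ?B (set vs)) * 2 ^ ?r"
    using card_generate_rows[OF len] by (simp add: order_xor_group)
  moreover have "card (generate ?B (set vs)) \<noteq> 0"
    using card_generate_rows[OF len] by (metis mult_0 power_not_zero zero_neq_numeral)
  ultimately have card_A: "card (carrier ?A) = 2 ^ ?r" by simp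
  interpret vectorspace F2 "milnor_mod2 n L" by (rule vectorspace_milnor_mod2)
  have carr: "carrier (milnor_mod2 n L) = carrier ?A" by (simp add: milnor_mod2_def F2_space_def)
  have "finite (carrier ?A)" using card_A by (metis card.infinite power_not_zero zero_neq_numeral)
  moreover have "card (carrier F2) = 2" by (simp add: carrier_F2)
  ultimately have "(2::nat) ^ ?r = 2 ^ dim"
    using card_carrier_eq_power_dim card_A by (simp only: carr)
  then have "dim = ?r" by simp
  then show ?thesis by (simp add: insert_blocks_eq vs_def)
qed

section \<open>Enumeration of the binary linking matrices\<close>

fun bit_lists :: "nat \<Rightarrow> bool list list" where
  "bit_lists 0 = [[]]"
| "bit_lists (Suc n) = map ((#) False) (bit_lists n) @ map ((#) True) (bit_lists n)"

lemma set_bit_lists: "set (bit_lists n) = {s. length s = n}"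
proof (induction n)
  case (Suc n)
  have "s \<in> (#) False ` {s. length s = n} \<union> (#) True ` {s. length s = n} \<longleftrightarrow> length s = Suc n"
    for s :: "bool list"
    by (cases s; cases "hd s") auto
  then show ?case using Suc by auto
qed simp

lemma distinct_bit_lists: "distinct (bit_lists n)"
  by (induction n) (auto simp: distinct_map)

lemma length_bit_lists: "length (bit_lists n) = 2 ^ n"
  by (induction n) auto

fun extend_rows :: "bool list list \<Rightarrow> bool list \<Rightarrow> bool list list" where
  "extend_rows (p # ps) (b # bs) = (p @ [b]) # extend_rows ps bs"
| "extend_rows _ _ = []"

lemma length_extend_rows [simp]: "length (extend_rows ps s) = min (length ps) (length s)"
  by (induction ps s rule: extend_rows.induct) auto

lemma nth_extend_rows: "i < length ps \<Longrightarrow> i < length s \<Longrightarrow> extend_rows ps s ! i = ps ! i @ [s ! i]"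
  by (induction ps s arbitrary: i rule: extend_rows.induct) (auto simp: nth_Cons split: nat.splits)

text \<open>The list \<open>ps\<close> holds the known initial parts of the rows that are still incomplete. When \<open>k\<close> rows
  are finished, symmetry makes each of these parts have length \<open>k\<close>. The next row continues with its
  diagonal entry \<open>False\<close> and a free choice \<open>s\<close>, and symmetry copies the bits of \<open>s\<close> to the ends of the
  parts that remain.\<close>
fun completions :: "bool list list \<Rightarrow> bool list list list" where
  "completions [] = [[]]"
| "completions (p # ps) = concat (map (\<lambda>s. map ((#) (p @ False # s)) (completions (extend_rows ps s)))
    (bit_lists (length ps)))"

lemma length_completions: "length (completions ps) = 2 ^ (length ps choose 2)"
proof (induction ps rule: completions.induct)
  case (2 p ps)
  have "length (completions (p # ps))
      = sum_list (map (\<lambda>s. length (completions (extend_rows ps s))) (bit_lists (length ps)))"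
    by (simp add: length_concat comp_def)
  also have "map (\<lambda>s. length (completions (extend_rows ps s))) (bit_lists (length ps)) =
      map (\<lambda>_. 2 ^ (length ps choose 2)) (bit_lists (length ps))"
    using 2 by (auto simp: set_bit_lists)
  also have "sum_list \<dots> = 2 ^ (length ps + (length ps choose 2))"
    by (simp add: sum_list_triv length_bit_lists power_add)
  also have "length ps + (length ps choose 2) = length (p # ps) choose 2"
    by (simp add: numeral_2_eq_2)
  finally show ?case .
qed (simp add: numeral_2_eq_2)

lemma distinct_completions: "distinct (completions ps)"
proof (induction ps rule: completions.induct)
  case (2 p ps)
  have "inj_on (\<lambda>s. map ((#) (p @ False # s)) (completions (extend_rows ps s)))
      (set (bit_lists (length ps)))"
  proof (rule inj_onI)
    fix s s'
    assume "map ((#) (p @ False # s)) (completions (extend_rows ps s)) =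
      map ((#) (p @ False # s')) (completions (extend_rows ps s'))"
    moreover have "completions (extend_rows ps s) \<noteq> []"
      using length_completions[of "extend_rows ps s"] by auto
    ultimately show "s = s'"
      by (cases "completions (extend_rows ps s)"; cases "completions (extend_rows ps s')") auto
  qed
  then show ?case
    unfolding completions.simps
    by (intro distinct_concat) (use 2 distinct_bit_lists in \<open>auto simp: distinct_map\<close>)
qed simp

text \<open>Row \<open>i\<close> of \<open>M\<close> is row \<open>k + i\<close> of the full matrix, hence the shift by \<open>k\<close> in all column
  indices.\<close>
lemma set_completions:
  assumes "\<forall>p\<in>set ps. length p = k"
  shows "M \<in> set (completions ps) \<longleftrightarrow> length M = length ps
    \<and> (\<forall>i<length ps. length (M ! i) = k + length ps \<and> take k (M ! i) = ps ! i \<and> \<not> M ! i ! (k + i))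
    \<and> (\<forall>i<length ps. \<forall>j<length ps. M ! i ! (k + j) = M ! j ! (k + i))"
  using assms
proof (induction ps arbitrary: k M rule: completions.induct)
  case (2 p ps)
  let ?m = "length ps"
  have p: "length p = k" and len: "\<forall>q\<in>set ps. length q = k" using 2 by auto
  have ext: "\<forall>q\<in>set (extend_rows ps s). length q = Suc k" if "length s = ?m" for s
    using that len by (simp add: all_set_conv_all_nth nth_extend_rows)
  have take_iff: "take (Suc k) x = q @ [b] \<longleftrightarrow> take k x = q \<and> x ! k = b"
    if "length x = Suc k + ?m" for x q and b :: bool
    using that by (auto simp: take_Suc_conv_app_nth)
  have IH: "M \<in> set (completions (extend_rows ps s)) \<longleftrightarrow> length M = ?m
    \<and> (\<forall>i<?m. length (M ! i) = Suc k + ?m \<and> take k (M ! i) = ps ! i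
        \<and> M ! i ! k = s ! i \<and> \<not> M ! i ! (Suc k + i))
    \<and> (\<forall>i<?m. \<forall>j<?m. M ! i ! (Suc k + j) = M ! j ! (Suc k + i))" if "length s = ?m" for s M
    using 2(1)[OF _ ext[OF that], of M] that by (simp add: set_bit_lists nth_extend_rows take_iff cong: conj_cong)
  have row: "(\<exists>s. length s = ?m \<and> u = p @ False # s \<and> P s) \<longleftrightarrow>
      length u = k + Suc ?m \<and> take k u = p \<and> \<not> u ! k \<and> P (drop (Suc k) u)" for u P
  proof
    assume u: "length u = k + Suc ?m \<and> take k u = p \<and> \<not> u ! k \<and> P (drop (Suc k) u)"
    then have "u = p @ False # drop (Suc k) u" using id_take_nth_drop[of k u] by simp
    then show "\<exists>s. length s = ?m \<and> u = p @ False # s \<and> P s"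
      using u by (intro exI[of _ "drop (Suc k) u"]) auto
  qed (use p in \<open>auto simp: nth_append\<close>)
  show ?case
  proof (cases M)
    case (Cons u M')
    have "M \<in> set (completions (p # ps)) \<longleftrightarrow>
        (\<exists>s. length s = ?m \<and> u = p @ False # s \<and> M' \<in> set (completions (extend_rows ps s)))"
      by (auto simp: Cons set_bit_lists)
    also have "\<dots> \<longleftrightarrow> length u = k + Suc ?m \<and> take k u = p \<and> \<not> u ! k \<and> length M' = ?m
      \<and> (\<forall>i<?m. length (M' ! i) = Suc k + ?m \<and> take k (M' ! i) = ps ! i
        \<and> M' ! i ! k = u ! (Suc k + i) \<and> \<not> M' ! i ! (Suc k + i))
      \<and> (\<forall>i<?m. \<forall>j<?m. M' ! i ! (Suc k + j) = M' ! j ! (Suc k + i))"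
      unfolding row by (auto simp: IH)
    also have "\<dots> \<longleftrightarrow> length M = length (p # ps)
      \<and> (\<forall>i<length (p # ps). length (M ! i) = k + length (p # ps)
        \<and> take k (M ! i) = (p # ps) ! i \<and> \<not> M ! i ! (k + i))
      \<and> (\<forall>i<length (p # ps). \<forall>j<length (p # ps). M ! i ! (k + j) = M ! j ! (k + i))"
      by (auto simp: Cons All_less_Suc2)
    finally show ?thesis .
  qed auto
qed simp

lemma bij_betw_adjacency_rows:
  "bij_betw (adjacency_rows n) (binary_linking_matrices n) (set (completions (replicate n [])))"
proof (rule bij_betw_byWitness[where f' = "\<lambda>M. mat n n (\<lambda>(i, k). of_bool (M ! k ! i))"])
  have C: "M \<in> set (completions (replicate n [])) \<longleftrightarrow> length M = n
     \<and> (\<forall>i<n. length (M ! i) = n \<and> \<not> M ! i ! i) \<and> (\<forall>i<n. \<forall>j<n. M ! i ! j = M ! j ! i)" for M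
    by (simp add: set_completions[where k = 0])
  show "\<forall>L\<in>binary_linking_matrices n. mat n n (\<lambda>(i, k). of_bool (adjacency_rows n L ! k ! i)) = L"
    by (auto simp: binary_linking_matrices_def linking_matrix_def adjacency_rows_def intro!: eq_matI, blast)
  show "\<forall>M\<in>set (completions (replicate n [])). adjacency_rows n (mat n n (\<lambda>(i, k). of_bool (M ! k ! i))) = M"
    by (auto simp: C adjacency_rows_def intro!: nth_equalityI)
  show "adjacency_rows n ` binary_linking_matrices n \<subseteq> set (completions (replicate n []))"
  proof
    fix M assume "M \<in> adjacency_rows n ` binary_linking_matrices n"
    then obtain L where L: "M = adjacency_rows n L" "L \<in> carrier_mat n n" "transpose_mat L = L"
      and d: "\<forall>i<n. L $$ (i, i) = 0"
      by (auto simp: binary_linking_matrices_def linking_matrix_def)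
    have "L $$ (i, j) = L $$ (j, i)" if "i < n" "j < n" for i j
      using L(2,3) that by (metis carrier_matD index_transpose_mat(1))
    then show "M \<in> set (completions (replicate n []))"
      using d by (auto simp: C L(1) adjacency_rows_def)
  qed
  show "(\<lambda>M. mat n n (\<lambda>(i, k). of_bool (M ! k ! i))) ` set (completions (replicate n []))
      \<subseteq> binary_linking_matrices n"
    by (auto simp: C binary_linking_matrices_def linking_matrix_def intro!: eq_matI)
qed

corollary card_binary_linking_matrices: "card (binary_linking_matrices n) = 2 ^ (n choose 2)"
  using bij_betw_same_card[OF bij_betw_adjacency_rows, of n]
  by (simp add: distinct_card distinct_completions length_completions)

section \<open>Counting by corank along the search tree\<close>

text \<open>Walking along the basis and the counters together, and advancing in the counters at free slots
  only, ends at the counter whose index is the corank.\<close>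
fun tally :: "echelon_basis \<Rightarrow> int list \<Rightarrow> int list" where
  "tally [] (x # xs) = (x + 1) # xs"
| "tally (Some p # bs) xs = tally bs xs"
| "tally (None # bs) (x # xs) = x # tally bs xs"
| "tally bs [] = []"

text \<open>The same recursion as \<open>completions\<close>, except that the block of a row is inserted as soon as the
  row is known. All matrices that agree up to this row share the resulting basis.\<close>
fun tally_completions ::
  "pattern list list \<Rightarrow> echelon_basis \<Rightarrow> bool list list \<Rightarrow> int list \<Rightarrow> int list" where
  "tally_completions (ts # tss) bs (p # ps) acc =
     fold (\<lambda>s. tally_completions tss (insert_block (p @ False # s) ts bs) (extend_rows ps s))
       (bit_lists (length ps)) acc"
| "tally_completions _ bs _ acc = tally bs acc"

definition histogram :: "nat \<Rightarrow> int list" where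
  "histogram n = (let m = length (triple_list n) in
     tally_completions (map (row_patterns n) [0..<n]) (replicate m None) (replicate n []) (replicate (Suc m) 0))"

lemma tally_completions_eq_fold:
  "length tss = length ps \<Longrightarrow>
    tally_completions tss bs ps acc = fold tally (map (\<lambda>M. insert_blocks M tss bs) (completions ps)) acc"
proof (induction tss arbitrary: bs ps acc)
  case Nil then show ?case by (simp add: insert_blocks_def)
next
  case (Cons ts tss)
  then obtain p qs where ps: "ps = p # qs" and len: "length tss = length qs" by (cases ps) auto
  have fc: "fold f (concat xss) = fold (fold f) xss" for f :: "'x \<Rightarrow> 'y \<Rightarrow> 'y" and xss
    by (induction xss) auto
  have "tally_completions (ts # tss) bs ps acc = fold (\<lambda>s. fold tally
      (map (\<lambda>M. insert_blocks M tss (insert_block (p @ False # s) ts bs)) (completions (extend_rows qs s))))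
      (bit_lists (length qs)) acc"
    unfolding ps tally_completions.simps
    by (rule List.fold_cong) (use len Cons.IH in \<open>auto simp: set_bit_lists\<close>)
  then show ?case
    by (simp add: ps map_concat comp_def fc fold_map insert_blocks_def)
qed

lemma tally_nth:
  assumes "corank bs < length acc"
  shows "length (tally bs acc) = length acc
    \<and> (\<forall>r<length acc. tally bs acc ! r = acc ! r + of_bool (corank bs = r))"
  using assms
  by (induction bs acc rule: tally.induct) (auto simp: corank_def nth_Cons split: nat.splits)

lemma fold_tally_nth:
  assumes "\<forall>bs\<in>set bss. corank bs < length acc"
  shows "length (fold tally bss acc) = length acc"
    and "r < length acc \<Longrightarrow> fold tally bss acc ! r = acc ! r + int (length (filter (\<lambda>bs. corank bs = r) bss))"
proof -
  have "length (fold tally bss acc) = length acc \<and> (r < length acc \<longrightarrow>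
      fold tally bss acc ! r = acc ! r + int (length (filter (\<lambda>bs. corank bs = r) bss)))"
    using assms by (induction bss arbitrary: acc) (auto simp: tally_nth)
  then show "length (fold tally bss acc) = length acc"
    "r < length acc \<Longrightarrow> fold tally bss acc ! r = acc ! r + int (length (filter (\<lambda>bs. corank bs = r) bss))"
    by blast+
qed

theorem histogram_nth:
  shows length_histogram: "length (histogram n) = Suc (length (triple_list n))"
    and "r \<le> length (triple_list n) \<Longrightarrow> histogram n ! r = int (num_linking n r)"
proof -
  let ?m = "length (triple_list n)" and ?tss = "map (row_patterns n) [0..<n]"
  let ?red = "\<lambda>M. insert_blocks M ?tss (replicate ?m None)" and ?C = "completions (replicate n [])"
  have "length (?red M) = ?m" if "M \<in> set ?C" for M
  proof -
    have "\<forall>v\<in>set (concat (map2 (\<lambda>u ts. map (fill_row u) ts) M ?tss)). length v = ?m"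
      by (auto simp: row_patterns_def fill_row_eq_map dest!: set_zip_rightD)
    then show ?thesis unfolding insert_blocks_eq using echelon_fold_insert_row by blast
  qed
  then have bound: "\<forall>bs\<in>set (map ?red ?C). corank bs < length (replicate (Suc ?m) (0::int))"
    by (auto simp: corank_def less_Suc_eq_le intro: order.trans[OF length_filter_le])
  have hist: "histogram n = fold tally (map ?red ?C) (replicate (Suc ?m) 0)"
    by (simp only: histogram_def Let_def tally_completions_eq_fold length_map length_upt length_replicate diff_zero)
  show "length (histogram n) = Suc ?m"
    unfolding hist fold_tally_nth(1)[OF bound] by simp
  have "num_linking n r = card {L \<in> binary_linking_matrices n. corank (?red (adjacency_rows n L)) = r}"
    unfolding num_linking_def by (rule arg_cong[where f = card]) (auto simp: dim_milnor_mod2)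
  also have "\<dots> = card {M \<in> set ?C. corank (?red M) = r}"
    by (rule bij_betw_same_card[of "adjacency_rows n"], rule bij_betw_Collect[OF bij_betw_adjacency_rows]) auto
  also have "\<dots> = length (filter (\<lambda>M. corank (?red M) = r) ?C)"
    using distinct_card[of "filter (\<lambda>M. corank (?red M) = r) ?C"] distinct_completions by simp
  finally show "histogram n ! r = int (num_linking n r)" if "r \<le> ?m"
    using that unfolding hist
    by (subst fold_tally_nth(2)[OF bound]) (auto simp: filter_map comp_def nth_replicate simp del: replicate_Suc)
qed

section \<open>Evaluation\<close>

text \<open>The contribution of the matrices whose first row is \<open>False # s\<close> with \<open>s\<close> in a given list, added
  to given counters. This allows the evaluation for \<open>n = 6\<close> to be divided into two independent
  computations, according to the entry of the matrix at the first two vertices.\<close>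
definition histogram_part :: "nat \<Rightarrow> bool list list \<Rightarrow> int list \<Rightarrow> int list" where
  "histogram_part n ss acc = (let tss = map (row_patterns n) [0..<n]; m = length (triple_list n) in
     fold (\<lambda>s. tally_completions (tl tss) (insert_block (False # s) (hd tss) (replicate m None))
       (extend_rows (replicate (length s) []) s)) ss acc)"

lemma histogram_part_append:
  "histogram_part n (ss @ ss') acc = histogram_part n ss' (histogram_part n ss acc)"
  by (simp add: histogram_part_def Let_def)

lemma histogram_eq_part:
  "histogram (Suc n) =
    histogram_part (Suc n) (bit_lists n) (replicate (Suc (length (triple_list (Suc n)))) 0)"
  unfolding histogram_def histogram_part_def Let_def upt_conv_Cons[OF zero_less_Suc] list.map
    replicate_Suc[of n] tally_completions.simps list.sel length_replicate append_Nil
  by (rule List.fold_cong) (auto simp: set_bit_lists)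

lemma histogram_4: "histogram 4 = [36, 21, 6, 0, 1]"
  by code_simp

lemma histogram_5: "histogram 5 = [132, 450, 180, 165, 46, 40, 0, 10, 0, 0, 1]"
  by code_simp

lemma histogram_6_without_first_edge:
  "histogram_part 6 (map ((#) False) (bit_lists 4)) (replicate 21 0) =
    [0, 0, 2352, 3492, 4266, 2076, 1000, 1882, 552, 188, 397, 57, 39, 68, 0, 0, 14, 0, 0, 0, 1]"
  by code_simp

text \<open>Starting from the counters of the other half makes the two evaluations compose to the
  whole.\<close>
lemma histogram_6_with_first_edge:
  "histogram_part 6 (map ((#) True) (bit_lists 4))
      [0, 0, 2352, 3492, 4266, 2076, 1000, 1882, 552, 188, 397, 57, 39, 68, 0, 0, 14, 0, 0, 0, 1] =
    [0, 0, 5712, 7920, 8595, 4035, 1627, 3030, 855, 240, 538, 75, 45, 80, 0, 0, 15, 0, 0, 0, 1]"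
  by code_simp

lemma histogram_6:
  "histogram 6 =
    [0, 0, 5712, 7920, 8595, 4035, 1627, 3030, 855, 240, 538, 75, 45, 80, 0, 0, 15, 0, 0, 0, 1]"
proof -
  have "length (triple_list 6) = 20" by code_simp
  moreover have "bit_lists 5 = map ((#) False) (bit_lists 4) @ map ((#) True) (bit_lists 4)"
    using bit_lists.simps(2)[of 4] by simp
  ultimately show ?thesis
    using histogram_eq_part[of 5] histogram_6_without_first_edge histogram_6_with_first_edge
    by (simp add: histogram_part_append del: bit_lists.simps replicate_Suc)
qed

lemma num_linking_eq_histogram:
  assumes "histogram n = map int hs" "r < length hs"
  shows "num_linking n r = hs ! r"
proof -
  have "length (histogram n) = Suc (length (triple_list n))" by (rule length_histogram)
  then have "r \<le> length (triple_list n)" using assms by simp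
  then show ?thesis using histogram_nth(2)[of r n] assms by simp
qed

theorem theorem1p6:
  shows
    "(\<forall>n\<ge>1. card (binary_linking_matrices n) = 2 ^ (n choose 2))
   \<and> (card (binary_linking_matrices 4) = 2 ^ 6
      \<and> num_linking 4 0 = 36 \<and> num_linking 4 1 = 21 \<and> num_linking 4 2 = 6
      \<and> num_linking 4 3 = 0 \<and> num_linking 4 4 = 1)
   \<and> (card (binary_linking_matrices 5) = 2 ^ 10
      \<and> num_linking 5 0 = 132 \<and> num_linking 5 1 = 450 \<and> num_linking 5 2 = 180
      \<and> num_linking 5 3 = 165 \<and> num_linking 5 4 = 46 \<and> num_linking 5 5 = 40
      \<and> num_linking 5 6 = 0 \<and> num_linking 5 7 = 10 \<and> num_linking 5 8 = 0
      \<and> num_linking 5 9 = 0 \<and> num_linking 5 10 = 1)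
   \<and> (card (binary_linking_matrices 6) = 2 ^ 15
      \<and> num_linking 6 0 = 0 \<and> num_linking 6 1 = 0 \<and> num_linking 6 2 = 5712
      \<and> num_linking 6 3 = 7920 \<and> num_linking 6 4 = 8595 \<and> num_linking 6 5 = 4035
      \<and> num_linking 6 6 = 1627 \<and> num_linking 6 7 = 3030 \<and> num_linking 6 8 = 855
      \<and> num_linking 6 9 = 240 \<and> num_linking 6 10 = 538 \<and> num_linking 6 11 = 75
      \<and> num_linking 6 12 = 45 \<and> num_linking 6 13 = 80 \<and> num_linking 6 14 = 0
      \<and> num_linking 6 15 = 0 \<and> num_linking 6 16 = 15 \<and> num_linking 6 17 = 0
      \<and> num_linking 6 18 = 0 \<and> num_linking 6 19 = 0 \<and> num_linking 6 20 = 1)"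
proof -
  have "num_linking 4 r = [36, 21, 6, 0, 1] ! r" if "r < 5" for r
    using that by (intro num_linking_eq_histogram) (simp_all add: histogram_4)
  moreover have "num_linking 5 r = [132, 450, 180, 165, 46, 40, 0, 10, 0, 0, 1] ! r" if "r < 11" for r
    using that by (intro num_linking_eq_histogram) (simp_all add: histogram_5)
  moreover have "num_linking 6 r =
      [0, 0, 5712, 7920, 8595, 4035, 1627, 3030, 855, 240, 538, 75, 45, 80, 0, 0, 15, 0, 0, 0, 1] ! r"
    if "r < 21" for r
    using that by (intro num_linking_eq_histogram) (simp_all add: histogram_6)
  ultimately show ?thesis
    by (simp add: card_binary_linking_matrices choose_two)
qed

end
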